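(* Let $M$ be a compact connected metric space and let $A:M\times M\to\mathbb{R}$ be a continuous function such that the associated real number $l$ (the asymptotic growth rate of the functions $A_n$) equals $0$. Let $c(x,y)=\liminf_{n\to\infty}A_n(x,y)$ and $\mathcal{A}=\{x\in M: c(x,x)=0\}$. A pair $(\phi_0,\phi_1)$ of real functions on $M$ is a Kantorovich admissible pair for $c$ if and only if the following three conditions hold: (i) $\phi_0$ is a fixed point of $T^+$; (ii) $\phi_1$ is a fixed point of $T^-$; (iii) $\phi_0=\phi_1$ on $\mathcal{A}$. Moreover, for each fixed point $\phi_1$ of $T^-$ there exists one and only one function $\phi_0$ such that $(\phi_0,\phi_1)$ is a Kantorovich admissible pair for $c$.
   Context: Set $A_1=A$ and, for $n\geq 2$, $A_n(x,y)=\min_{z_1,\ldots,z_{n-1}\in M}\big(A(x,z_1)+A(z_1,z_2)+\cdots+A(z_{n-1},y)\big)$. For any continuous $A$ on $M\times M$ the functions $A_n$ are equicontinuous and there are a (unique) real number $l$ and a positive constant $C$ such that $|A_n(x,y)-ln|\leq C$ for all $n\geq 1$ and all $x,y\in M$. When $l=0$ the function $c$ is finite and continuous on $M\times M$. A pair $(\phi_0,\phi_1)$ of real functions on $M$ is a Kantorovich admissible pair for $c$ if $\phi_1(y)=\min_{x\in M}\big(\phi_0(x)+c(x,y)\big)$ for all $y\in M$ and $\phi_0(x)=\max_{y\in M}\big(\phi_1(y)-c(x,y)\big)$ for all $x\in M$. The operators $T^{\pm}$ act on the space $C(M,\mathbb{R})$ of continuous real functions on $M$ by $T^-u(x)=\min_{y\in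 M}\big(u(y)+A(y,x)\big)$ and $T^+u(x)=\max_{y\in M}\big(u(y)-A(x,y)\big)$; a fixed point of $T^\pm$ is a function $u\in C(M,\mathbb{R})$ with $T^\pm u=u$. *)

theory Defs
  imports "HOL-Analysis.Analysis"
begin

text \<open>
  The space M is the universe of a type of class \<open>metric_space\<close>; compactness and
  connectedness of \<open>UNIV\<close> are hypotheses of the theorem.
  A cost is a curried function \<open>A :: 'a \<Rightarrow> 'a \<Rightarrow> real\<close>.
\<close>

text \<open>
  The minimal cost of an n-step chain from x to y, with \<open>z 0 = x\<close> and \<open>z n = y\<close>.
  Only \<open>n \<ge> 1\<close> is meaningful. For continuous \<open>A\<close> on a compact space the infimum is a minimum
  (lemma \<open>step_cost_attained\<close>).
\<close>
definition step_cost :: "('a \<Rightarrow> 'a \<Rightarrow> real) \<Rightarrow> nat \<Rightarrow> 'a \<Rightarrow> 'a \<Rightarrow> real" where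
  "step_cost A n x y =
     Inf {(\<Sum>i<n. A (z i) (z (Suc i))) | z. z 0 = x \<and> z n = y}"

definition has_growth_rate :: "('a \<Rightarrow> 'a \<Rightarrow> real) \<Rightarrow> real \<Rightarrow> bool" where
  "has_growth_rate A l \<longleftrightarrow>
     (\<exists>C>0. \<forall>n\<ge>1. \<forall>x y. \<bar>step_cost A n x y - l * real n\<bar> \<le> C)"

text \<open>
  The liminf is taken in the extended reals; it is finite when the growth rate is 0
  (lemma \<open>limit_cost_finite\<close>).
\<close>
definition limit_cost :: "('a \<Rightarrow> 'a \<Rightarrow> real) \<Rightarrow> 'a \<Rightarrow> 'a \<Rightarrow> real" where
  "limit_cost A x y = real_of_ereal (liminf (\<lambda>n. ereal (step_cost A n x y)))"

definition aubry_set :: "('a \<Rightarrow> 'a \<Rightarrow> real) \<Rightarrow> 'a set" where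
  "aubry_set A = {x. limit_cost A x x = 0}"

text \<open>
  The functions of an admissible pair are arbitrary, so the extrema in its definition
  are required to be attained rather than expressed by \<open>Inf\<close> and \<open>Sup\<close>.
\<close>
definition is_min :: "('a \<Rightarrow> real) \<Rightarrow> real \<Rightarrow> bool" where
  "is_min f m \<longleftrightarrow> m \<in> range f \<and> (\<forall>x. m \<le> f x)"

definition is_max :: "('a \<Rightarrow> real) \<Rightarrow> real \<Rightarrow> bool" where
  "is_max f m \<longleftrightarrow> m \<in> range f \<and> (\<forall>x. f x \<le> m)"

definition kantorovich_pair ::
    "('a \<Rightarrow> 'a \<Rightarrow> real) \<Rightarrow> ('a \<Rightarrow> real) \<Rightarrow> ('a \<Rightarrow> real) \<Rightarrow> bool" where
  "kantorovich_pair c \<phi>\<^sub>0 \<phi>\<^sub>1 \<longleftrightarrow>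
     (\<forall>y. is_min (\<lambda>x. \<phi>\<^sub>0 x + c x y) (\<phi>\<^sub>1 y)) \<and>
     (\<forall>x. is_max (\<lambda>y. \<phi>\<^sub>1 y - c x y) (\<phi>\<^sub>0 x))"

text \<open>
  The operators are applied to continuous functions only, where the infimum and the supremum
  are a minimum and a maximum (lemmas \<open>T_minus_is_min\<close> and \<open>T_plus_is_max\<close>).
\<close>
definition T_minus :: "('a \<Rightarrow> 'a \<Rightarrow> real) \<Rightarrow> ('a \<Rightarrow> real) \<Rightarrow> 'a \<Rightarrow> real" where
  "T_minus A u x = (INF y. u y + A y x)"

definition T_plus :: "('a \<Rightarrow> 'a \<Rightarrow> real) \<Rightarrow> ('a \<Rightarrow> real) \<Rightarrow> 'a \<Rightarrow> real" where
  "T_plus A u x = (SUP y. u y - A x y)"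

definition fixed_point ::
    "(('a \<Rightarrow> real) \<Rightarrow> 'a \<Rightarrow> real) \<Rightarrow> ('a::topological_space \<Rightarrow> real) \<Rightarrow> bool" where
  "fixed_point T u \<longleftrightarrow> continuous_on UNIV u \<and> T u = u"

lemma is_min_INF:
  fixes f :: "'a::topological_space \<Rightarrow> real"
  assumes "compact (UNIV :: 'a set)" and "continuous_on UNIV f"
  shows "is_min f (INF x. f x)"
proof -
  obtain x where x: "\<And>y. f x \<le> f y"
    using continuous_attains_inf[of UNIV f] assms by auto
  have "(INF x. f x) = f x"
    by (rule cInf_eq_minimum) (use x in auto)
  then show ?thesis using x by (auto simp: is_min_def)
qed

lemma is_max_SUP:
  fixes f :: "'a::topological_space \<Rightarrow> real"
  assumes "compact (UNIV :: 'a set)" and "continuous_on UNIV f"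
  shows "is_max f (SUP x. f x)"
proof -
  obtain x where x: "\<And>y. f y \<le> f x"
    using continuous_attains_sup[of UNIV f] assms by auto
  have "(SUP x. f x) = f x"
    by (rule cSup_eq_maximum) (use x in auto)
  then show ?thesis using x by (auto simp: is_max_def)
qed

lemma T_minus_is_min:
  fixes A :: "'a::metric_space \<Rightarrow> 'a \<Rightarrow> real"
  assumes "compact (UNIV :: 'a set)" and "continuous_on UNIV (\<lambda>(x, y). A x y)"
    and "continuous_on UNIV u"
  shows "is_min (\<lambda>y. u y + A y x) (T_minus A u x)"
proof -
  have "continuous_on UNIV (\<lambda>y. (y, x))"
    by (intro continuous_intros)
  from continuous_on_compose2[OF assms(2) this]
  have "continuous_on UNIV (\<lambda>y. A y x)" by simp
  then show ?thesis unfolding T_minus_def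
    by (intro is_min_INF assms continuous_intros)
qed

lemma T_plus_is_max:
  fixes A :: "'a::metric_space \<Rightarrow> 'a \<Rightarrow> real"
  assumes "compact (UNIV :: 'a set)" and "continuous_on UNIV (\<lambda>(x, y). A x y)"
    and "continuous_on UNIV u"
  shows "is_max (\<lambda>y. u y - A x y) (T_plus A u x)"
proof -
  have "continuous_on UNIV (\<lambda>y. (x, y))"
    by (intro continuous_intros)
  from continuous_on_compose2[OF assms(2) this]
  have "continuous_on UNIV (\<lambda>y. A x y)" by simp
  then show ?thesis unfolding T_plus_def
    by (intro is_max_SUP assms continuous_intros)
qed

lemma step_cost_attained:
  fixes A :: "'a::metric_space \<Rightarrow> 'a \<Rightarrow> real"
  assumes "compact (UNIV :: 'a set)" and A: "continuous_on UNIV (\<lambda>(x, y). A x y)"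
    and "n \<ge> 1"
  shows "\<exists>z. z 0 = x \<and> z n = y \<and> step_cost A n x y = (\<Sum>i<n. A (z i) (z (Suc i)))"
proof -
  let ?X = "\<lambda>i. if i = 0 then {x} else if i = n then {y} else (UNIV :: 'a set)"
  let ?S = "{z :: nat \<Rightarrow> 'a. z 0 = x \<and> z n = y}"
  let ?f = "\<lambda>z. \<Sum>i<n. A (z i) (z (Suc i))"
  have S: "?S = PiE UNIV ?X"
    using \<open>n \<ge> 1\<close> by (auto simp: PiE_def Pi_def split: if_splits)
  have "compactin (product_topology (\<lambda>i. euclidean) UNIV) (PiE UNIV ?X)"
    unfolding compactin_PiE using assms(1) by auto
  then have "compact ?S"
    unfolding S euclidean_product_topology by simp
  moreover have "(\<lambda>i. if i = 0 then x else y) \<in> ?S" using \<open>n \<ge> 1\<close> by simp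
  moreover have "continuous_on ?S ?f"
  proof (intro continuous_on_sum)
    fix i
    have "continuous_on ?S (\<lambda>z. (z i, z (Suc i)))"
      by (intro continuous_intros continuous_on_product_coordinates
          continuous_on_subset[OF continuous_on_product_coordinates]) auto
    from continuous_on_compose2[OF A this]
    show "continuous_on ?S (\<lambda>z. A (z i) (z (Suc i)))" by simp
  qed
  ultimately have "\<exists>z\<in>?S. \<forall>w\<in>?S. ?f z \<le> ?f w"
    by (intro continuous_attains_inf) (simp, metis empty_iff, simp)
  then obtain z where z: "z \<in> ?S" "\<And>w. w \<in> ?S \<Longrightarrow> ?f z \<le> ?f w"
    by (elim bexE) simp
  have "step_cost A n x y = ?f z"
    unfolding step_cost_def by (rule cInf_eq_minimum) (use z in auto)
  then show ?thesis using z(1) by blast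
qed

lemma has_growth_rate_unique:
  assumes "has_growth_rate A l" and "has_growth_rate A l'"
  shows "l = l'"
proof (rule ccontr)
  assume "l \<noteq> l'"
  obtain C where C: "\<And>n x y. n \<ge> 1 \<Longrightarrow> \<bar>step_cost A n x y - l * real n\<bar> \<le> C"
    using assms(1) by (auto simp: has_growth_rate_def)
  obtain C' where C': "\<And>n x y. n \<ge> 1 \<Longrightarrow> \<bar>step_cost A n x y - l' * real n\<bar> \<le> C'"
    using assms(2) by (auto simp: has_growth_rate_def)
  obtain n where n: "C + C' < real n * \<bar>l - l'\<bar>"
    using \<open>l \<noteq> l'\<close> reals_Archimedean3[of "\<bar>l - l'\<bar>"] by auto
  have C0: "0 \<le> C" "0 \<le> C'"
    using C[of 1 undefined undefined] C'[of 1 undefined undefined] by linarith+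
  have "n \<ge> 1" using n C0 by (cases n) auto
  then have "\<bar>l * real n - l' * real n\<bar> \<le> C + C'"
    using C[of n undefined undefined] C'[of n undefined undefined] by linarith
  then show False
    using n by (simp add: abs_mult mult.commute flip: left_diff_distrib)
qed

lemma limit_cost_finite:
  assumes "has_growth_rate A 0"
  shows "\<bar>liminf (\<lambda>n. ereal (step_cost A n x y))\<bar> \<noteq> \<infinity>"
proof -
  obtain C where C: "\<And>n. n \<ge> 1 \<Longrightarrow> \<bar>step_cost A n x y\<bar> \<le> C"
    using assms by (auto simp: has_growth_rate_def)
  have "\<forall>\<^sub>F n in sequentially. ereal (- C) \<le> ereal (step_cost A n x y)"
    using C by (intro eventually_sequentiallyI[of 1]) (force simp: abs_le_iff)
  then have "ereal (- C) \<le> liminf (\<lambda>n. ereal (step_cost A n x y))"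
    by (rule Liminf_bounded)
  moreover have "\<forall>\<^sub>F n in sequentially. ereal (step_cost A n x y) \<le> ereal C"
    using C by (intro eventually_sequentiallyI[of 1]) (force simp: abs_le_iff)
  then have "limsup (\<lambda>n. ereal (step_cost A n x y)) \<le> ereal C"
    by (rule Limsup_bounded)
  then have "liminf (\<lambda>n. ereal (step_cost A n x y)) \<le> ereal C"
    using Liminf_le_Limsup[of sequentially "\<lambda>n. ereal (step_cost A n x y)"]
    by (meson order_trans trivial_limit_sequentially)
  ultimately show ?thesis by auto
qed

end

theory Submission
  imports Defs
begin

text \<open>
  A fixed point \<open>u\<close> of \<open>T\<^sup>-\<close> satisfies \<open>u y \<le> u x + c x y\<close>. Following
  backwards from \<open>y\<close> the points where the minimum in \<open>T\<^sup>- u = u\<close> is attained and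
  extracting a limit point \<open>\<alpha>\<close> of this orbit gives \<open>\<alpha> \<in> \<A>\<close> with
  \<open>u y = u \<alpha> + c \<alpha> y\<close>. Since \<open>c x\<close> is itself a fixed point of
  \<open>T\<^sup>-\<close>, this representation also shows that \<open>c x y = c x \<alpha> + c \<alpha> y\<close> for some
  \<open>\<alpha> \<in> \<A>\<close>. These two facts, together with their images under the symmetry that
  transposes the cost and replaces \<open>(\<phi>\<^sub>0, \<phi>\<^sub>1)\<close> by \<open>(- \<phi>\<^sub>1, - \<phi>\<^sub>0)\<close>, imply the theorem.
\<close>

lemma is_min_unique: "is_min f a \<Longrightarrow> is_min f b \<Longrightarrow> a = b"
  by (force simp: is_min_def intro: antisym)

lemma is_max_unique: "is_max f a \<Longrightarrow> is_max f b \<Longrightarrow> a = b"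
  by (force simp: is_max_def intro: antisym)

section \<open>Transposed costs\<close>

text \<open>Reversing a chain by \<open>i \<mapsto> n - i\<close> exchanges its endpoints and
  transposes every link.\<close>

lemma step_cost_transpose: "step_cost (\<lambda>x y. A y x) n x y = step_cost A n y x"
proof -
  \<comment> \<open>With \<open>B\<close> and the endpoints arbitrary, the two instances at
    \<open>A\<close> and at its transpose give both inclusions between the sets of chain
    sums.\<close>
  have sub: "{(\<Sum>i<n. B (z i) (z (Suc i))) | z. z 0 = x \<and> z n = y}
      \<subseteq> {(\<Sum>i<n. B (z (Suc i)) (z i)) | z. z 0 = y \<and> z n = x}"
    for B :: "'a \<Rightarrow> 'a \<Rightarrow> real" and x y
  proof safe
    fix z :: "nat \<Rightarrow> 'a"
    let ?w = "\<lambda>i. z (n - i)"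
    have "(\<Sum>i<n. B (z i) (z (Suc i))) =
        (\<Sum>i<n. B (z (n - Suc i)) (z (Suc (n - Suc i))))"
      by (rule sum.nat_diff_reindex[symmetric])
    also have "\<dots> = (\<Sum>i<n. B (?w (Suc i)) (?w i))"
      by (intro sum.cong) (auto simp: Suc_diff_Suc)
    finally show "\<exists>w. (\<Sum>i<n. B (z i) (z (Suc i))) = (\<Sum>i<n. B (w (Suc i)) (w i))
        \<and> w 0 = z n \<and> w n = z 0"
      by (intro exI[of _ ?w]) simp
  qed
  show ?thesis
    unfolding step_cost_def
    using sub[of "\<lambda>x y. A y x" x y] sub[of A y x] by (intro arg_cong[of _ _ Inf]) blast
qed

lemma limit_cost_transpose: "limit_cost (\<lambda>x y. A y x) x y = limit_cost A y x"
  by (simp add: limit_cost_def step_cost_transpose[of A])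

lemma aubry_set_transpose: "aubry_set (\<lambda>x y. A y x) = aubry_set A"
  by (simp add: aubry_set_def limit_cost_transpose[of A])

lemma has_growth_rate_transpose:
  "has_growth_rate (\<lambda>x y. A y x) l \<longleftrightarrow> has_growth_rate A l"
  unfolding has_growth_rate_def step_cost_transpose[of A] by blast

lemma is_min_uminus: "is_min (\<lambda>x. - f x) (- m) \<longleftrightarrow> is_max f m"
  by (auto simp: is_min_def is_max_def image_iff)

lemma kantorovich_pair_transpose:
  "kantorovich_pair (\<lambda>x y. c y x) (\<lambda>x. - \<phi>\<^sub>1 x) (\<lambda>x. - \<phi>\<^sub>0 x) \<longleftrightarrow> kantorovich_pair c \<phi>\<^sub>0 \<phi>\<^sub>1"
proof -
  have "is_min (\<lambda>y. - \<phi>\<^sub>1 y + c x y) (- \<phi>\<^sub>0 x) \<longleftrightarrow> is_max (\<lambda>y. \<phi>\<^sub>1 y - c x y) (\<phi>\<^sub>0 x)" for x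
    using is_min_uminus[of "\<lambda>y. \<phi>\<^sub>1 y - c x y"] by (simp add: algebra_simps)
  moreover have "is_max (\<lambda>x. - \<phi>\<^sub>0 x - c x y) (- \<phi>\<^sub>1 y) \<longleftrightarrow> is_min (\<lambda>x. \<phi>\<^sub>0 x + c x y) (\<phi>\<^sub>1 y)" for y
    using is_min_uminus[of "\<lambda>x. - \<phi>\<^sub>0 x - c x y" "- \<phi>\<^sub>1 y"] by (simp add: algebra_simps)
  ultimately show ?thesis by (auto simp: kantorovich_pair_def)
qed

text \<open>On the reals \<open>Inf\<close> is defined as minus the \<open>Sup\<close> of the
  negated set, so the identity holds for every \<open>u\<close>, bounded or not.\<close>

lemma T_minus_transpose: "T_minus (\<lambda>x y. A y x) (\<lambda>x. - u x) x = - T_plus A u x"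
  unfolding T_minus_def T_plus_def Inf_real_def image_image by (simp add: algebra_simps)

lemma fixed_point_T_plus_iff:
  "fixed_point (T_plus A) u \<longleftrightarrow> fixed_point (T_minus (\<lambda>x y. A y x)) (\<lambda>x. - u x)"
  unfolding fixed_point_def fun_eq_iff T_minus_transpose
  using continuous_on_minus[of UNIV u] continuous_on_minus[of UNIV "\<lambda>x. - u x"] by auto

section \<open>The limit cost\<close>

text \<open>These hypotheses are invariant under transposition, so interpreting the locale at the
  transposed cost yields the mirror image of each lemma.\<close>

locale zero_growth_cost =
  fixes A :: "'a::metric_space \<Rightarrow> 'a \<Rightarrow> real"
  assumes compact: "compact (UNIV :: 'a set)"
    and continuous: "continuous_on UNIV (\<lambda>(x, y). A x y)"
    and growth: "has_growth_rate A 0"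
begin

lemma transpose: "zero_growth_cost (\<lambda>x y. A y x)"
proof
  have "continuous_on UNIV (\<lambda>p::'a \<times> 'a. (snd p, fst p))"
    by (intro continuous_intros)
  from continuous_on_compose2[OF continuous this]
  show "continuous_on UNIV (\<lambda>(x, y). A y x)" by (simp add: case_prod_beta)
qed (use compact growth in \<open>auto simp: has_growth_rate_transpose[of A]\<close>)

lemma convergent_subsequence:
  obtains r :: "nat \<Rightarrow> nat" and l :: 'a
  where "strict_mono r" "(\<lambda>k. w (r k)) \<longlonglongrightarrow> l"
  using compact unfolding compact_def o_def by (metis UNIV_I)

lemma tendsto_cost:
  assumes "(v \<longlongrightarrow> a) F" "(w \<longlongrightarrow> b) F"
  shows "((\<lambda>k. A (v k) (w k)) \<longlongrightarrow> A a b) F"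
proof -
  have "((\<lambda>k. case (v k, w k) of (x, y) \<Rightarrow> A x y) \<longlongrightarrow> (case (a, b) of (x, y) \<Rightarrow> A x y)) F"
    by (rule continuous_on_tendsto_compose[OF continuous]) (use assms in \<open>auto intro: tendsto_Pair\<close>)
  then show ?thesis by simp
qed

lemma uniform_modulus:
  assumes "e > 0"
  obtains d where "d > 0" "\<And>x y y'. dist y y' < d \<Longrightarrow> \<bar>A x y - A x y'\<bar> < e"
proof -
  have "compact (UNIV :: ('a \<times> 'a) set)"
    using compact_Times[OF compact compact] by simp
  from compact_uniformly_continuous[OF continuous this]
  obtain d where d: "d > 0" "\<And>p q. dist p q < d \<Longrightarrow> dist (case p of (x, y) \<Rightarrow> A x y) (case q of (x, y) \<Rightarrow> A x y) < e"
    using assms unfolding uniformly_continuous_on_def by (metis UNIV_I)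
  show thesis
  proof
    fix x y y' :: 'a
    assume "dist y y' < d"
    then show "\<bar>A x y - A x y'\<bar> < e"
      using d(2)[of "(x, y)" "(x, y')"] by (simp add: dist_Pair_Pair dist_real_def)
  qed (fact d)
qed

section \<open>Finite chains: optimality and equicontinuity\<close>

lemma step_cost_le:
  assumes "z 0 = x" "z n = y"
  shows "step_cost A n x y \<le> (\<Sum>i<n. A (z i) (z (Suc i)))"
proof -
  have "compact (UNIV :: ('a \<times> 'a) set)"
    using compact_Times[OF compact compact] by simp
  \<comment> \<open>A lower bound \<open>m\<close> of \<open>A\<close> keeps the chain sums above
    \<open>real n * m\<close>, so their infimum is a genuine lower bound.\<close>
  from continuous_attains_inf[OF this _ continuous]
  obtain m where m: "\<And>x y. m \<le> A x y" by auto
  have "real n * m \<le> (\<Sum>i<n. A (w i) (w (Suc i)))" for w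
    using sum_bounded_below[of "{..<n}" m "\<lambda>i. A (w i) (w (Suc i))"] m by simp
  then show ?thesis
    unfolding step_cost_def using assms
    by (intro cInf_lower) (auto intro!: bdd_belowI[of _ "real n * m"])
qed

lemma step_cost_Suc_le:
  assumes "n \<ge> 1"
  shows "step_cost A (Suc n) x y \<le> step_cost A n x z + A z y"
proof -
  obtain w where w: "w 0 = x" "w n = z" "step_cost A n x z = (\<Sum>i<n. A (w i) (w (Suc i)))"
    using step_cost_attained[OF compact continuous assms] by blast
  show ?thesis
    using step_cost_le[of "w(Suc n := y)" x "Suc n" y] w by simp
qed

text \<open>Principle of optimality: an optimal chain with its last link removed is still optimal,
  and \<open>z\<close> is its last but one point.\<close>

lemma step_cost_Suc_split:
  assumes "n \<ge> 1"
  obtains z where "step_cost A (Suc n) x y = step_cost A n x z + A z y"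
proof -
  obtain w where w: "w 0 = x" "w (Suc n) = y"
      "step_cost A (Suc n) x y = (\<Sum>i<Suc n. A (w i) (w (Suc i)))"
    using step_cost_attained[OF compact continuous, of "Suc n"] by (metis le_add1 plus_1_eq_Suc)
  have "step_cost A (Suc n) x y = step_cost A n x (w n) + A (w n) y"
    using step_cost_le[of w x n "w n"] step_cost_Suc_le[OF assms, of x y "w n"] w by simp
  then show thesis by (rule that)
qed

text \<open>Moving the endpoint of an optimal chain changes only its last link, so the modulus of
  \<open>A\<close> in its second argument serves for all \<open>n\<close> and \<open>x\<close> at
  once.\<close>

lemma step_cost_modulus:
  assumes "e > 0"
  obtains d where "d > 0"
    "\<And>n x y y'. n \<ge> 1 \<Longrightarrow> dist y y' < d \<Longrightarrow> step_cost A n x y' \<le> step_cost A n x y + e"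
proof -
  obtain d where d: "d > 0" "\<And>x y y'. dist y y' < d \<Longrightarrow> \<bar>A x y - A x y'\<bar> < e"
    using uniform_modulus[OF assms] by blast
  show thesis
  proof
    fix n :: nat and x y y' :: 'a
    assume "n \<ge> 1" and dist: "dist y y' < d"
    then obtain m where n: "n = Suc m" by (cases n) auto
    obtain w where w: "w 0 = x" "w n = y" "step_cost A n x y = (\<Sum>i<n. A (w i) (w (Suc i)))"
      using step_cost_attained[OF compact continuous \<open>n \<ge> 1\<close>] by blast
    show "step_cost A n x y' \<le> step_cost A n x y + e"
      using step_cost_le[of "w(n := y')" x n y'] w d(2)[OF dist, of "w m"] by (simp add: n)
  qed (fact d)
qed

text \<open>The modulus is uniform in the length and the starting point, so both may vary with
  \<open>k\<close>.\<close>

lemma step_cost_end_tendsto_0: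
  assumes "w \<longlonglongrightarrow> b" "filterlim r at_top sequentially"
  shows "(\<lambda>k. step_cost A (r k) (v k) (w k) - step_cost A (r k) (v k) b) \<longlonglongrightarrow> 0"
proof (rule tendstoI)
  fix e :: real
  assume "e > 0"
  then obtain d where d: "d > 0"
      "\<And>n x y y'. n \<ge> 1 \<Longrightarrow> dist y y' < d \<Longrightarrow> step_cost A n x y' \<le> step_cost A n x y + e / 2"
    using step_cost_modulus[of "e / 2"] by auto
  have "\<forall>\<^sub>F k in sequentially. dist (w k) b < d" "\<forall>\<^sub>F k in sequentially. 1 \<le> r k"
    using assms d(1) by (auto dest: tendstoD simp: filterlim_at_top)
  then show "\<forall>\<^sub>F k in sequentially.
      dist (step_cost A (r k) (v k) (w k) - step_cost A (r k) (v k) b) 0 < e"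
  proof eventually_elim
    case (elim k)
    then show ?case
      using d(2)[of "r k" "w k" b "v k"]
        d(2)[of "r k" b "w k" "v k"] \<open>e > 0\<close>
      by (auto simp: dist_real_def dist_commute)
  qed
qed

section \<open>Passage to the lower limit\<close>

lemma limit_cost_subsequence:
  obtains r where "strict_mono r" "(\<lambda>k. step_cost A (r k) x y) \<longlonglongrightarrow> limit_cost A x y"
proof -
  obtain r where r: "strict_mono r"
      "((\<lambda>n. ereal (step_cost A n x y)) \<circ> r) \<longlonglongrightarrow> liminf (\<lambda>n. ereal (step_cost A n x y))"
    using liminf_subseq_lim by blast
  have "liminf (\<lambda>n. ereal (step_cost A n x y)) = ereal (limit_cost A x y)"
    unfolding limit_cost_def using limit_cost_finite[OF growth] by (simp add: ereal_real)
  with r show thesis by (intro that[of r]) (simp_all add: o_def)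
qed

text \<open>The lengths \<open>r\<close> need only tend to infinity, not increase; this permits
  differences of indices as lengths.\<close>

lemma limit_cost_le:
  assumes r: "filterlim r at_top sequentially"
    and le: "\<forall>\<^sub>F k in sequentially. step_cost A (r k) x y \<le> b k" and b: "b \<longlonglongrightarrow> a"
  shows "limit_cost A x y \<le> a"
proof (rule dense_le)
  fix e
  \<comment> \<open>A number below the liminf is eventually below the step costs, hence also along
    \<open>r\<close>.\<close>
  assume "e < limit_cost A x y"
  moreover have "liminf (\<lambda>n. ereal (step_cost A n x y)) = ereal (limit_cost A x y)"
    unfolding limit_cost_def using limit_cost_finite[OF growth] by (simp add: ereal_real)
  ultimately have "\<forall>\<^sub>F n in sequentially. ereal e < ereal (step_cost A n x y)"
    by (intro less_LiminfD) simp
  from eventually_compose_filterlim[OF this r]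
  have "\<forall>\<^sub>F k in sequentially. e < step_cost A (r k) x y" by simp
  with le have "\<forall>\<^sub>F k in sequentially. e \<le> b k"
    by eventually_elim simp
  with b show "e \<le> a"
    by (intro tendsto_lowerbound) auto
qed

text \<open>Equicontinuity allows the moving endpoints to be replaced by their limits, one at a
  time; the starting point is an end point for the transposed cost.\<close>

lemma limit_cost_le_limit:
  assumes v: "v \<longlonglongrightarrow> x" and w: "w \<longlonglongrightarrow> y" and r: "filterlim r at_top sequentially"
    and lim: "(\<lambda>k. step_cost A (r k) (v k) (w k)) \<longlonglongrightarrow> a"
  shows "limit_cost A x y \<le> a"
proof (rule limit_cost_le[OF r])
  interpret T: zero_growth_cost "\<lambda>x y. A y x" by (rule transpose)
  have "(\<lambda>k. step_cost A (r k) (v k) y - step_cost A (r k) x y) \<longlonglongrightarrow> 0"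
    using T.step_cost_end_tendsto_0[OF v r, of "\<lambda>_. y"] by (simp add: step_cost_transpose[of A])
  from tendsto_add[OF this step_cost_end_tendsto_0[OF w r, of v]] lim
  have "(\<lambda>k. step_cost A (r k) (v k) (w k) -
      (step_cost A (r k) (v k) y - step_cost A (r k) x y +
       (step_cost A (r k) (v k) (w k) - step_cost A (r k) (v k) y))) \<longlonglongrightarrow> a - (0 + 0)"
    by (intro tendsto_diff)
  then show "(\<lambda>k. step_cost A (r k) x y) \<longlonglongrightarrow> a" by (simp add: algebra_simps)
qed simp

lemma limit_cost_modulus:
  assumes "e > 0"
  obtains d where "d > 0"
    "\<And>x y y'. dist y y' < d \<Longrightarrow> limit_cost A x y' \<le> limit_cost A x y + e"
proof -
  obtain d where d: "d > 0"
    "\<And>n x y y'. n \<ge> 1 \<Longrightarrow> dist y y' < d \<Longrightarrow> step_cost A n x y' \<le> step_cost A n x y + e"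
    using step_cost_modulus[OF assms] by blast
  show thesis
  proof
    fix x y y' :: 'a
    assume dist: "dist y y' < d"
    obtain r where r: "strict_mono r" "(\<lambda>k. step_cost A (r k) x y) \<longlonglongrightarrow> limit_cost A x y"
      by (rule limit_cost_subsequence)
    have lim: "filterlim r at_top sequentially" by (rule filterlim_subseq[OF r(1)])
    then have "\<forall>\<^sub>F k in sequentially. 1 \<le> r k" by (simp add: filterlim_at_top)
    then have "\<forall>\<^sub>F k in sequentially. step_cost A (r k) x y' \<le> step_cost A (r k) x y + e"
      by eventually_elim (rule d(2)[OF _ dist])
    then show "limit_cost A x y' \<le> limit_cost A x y + e"
      by (rule limit_cost_le[OF lim]) (intro tendsto_intros r(2))
  qed (fact d)
qed

section \<open>Fixed points\<close>

text \<open>For continuous \<open>u\<close> the infimum in \<open>T_minus\<close> is attained, so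
  \<open>T_minus A u = u\<close> splits into a one-step domination and the existence of an optimal
  predecessor.\<close>

lemma fixed_point_T_minus_iff:
  "fixed_point (T_minus A) u \<longleftrightarrow> continuous_on UNIV u \<and>
     (\<forall>x y. u y \<le> u x + A x y) \<and> (\<forall>y. \<exists>x. u y = u x + A x y)"
proof -
  have "T_minus A u = u \<longleftrightarrow> (\<forall>y. is_min (\<lambda>x. u x + A x y) (u y))" if "continuous_on UNIV u"
    using T_minus_is_min[OF compact continuous that] unfolding fun_eq_iff
    by (metis is_min_unique)
  then show ?thesis
    unfolding fixed_point_def is_min_def image_iff by auto
qed

lemma continuous_on_limit_cost: "continuous_on UNIV (limit_cost A x)"
proof (unfold continuous_on_iff, intro ballI allI impI)
  fix y and e :: real
  assume "e > 0"
  then obtain d where d: "d > 0"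
      "\<And>x y y'. dist y y' < d \<Longrightarrow> limit_cost A x y' \<le> limit_cost A x y + e / 2"
    using limit_cost_modulus[of "e / 2"] by auto
  show "\<exists>d>0. \<forall>y'\<in>UNIV. dist y' y < d \<longrightarrow> dist (limit_cost A x y') (limit_cost A x y) < e"
  proof (intro exI conjI ballI impI)
    fix y'
    assume "dist y' y < d"
    then show "dist (limit_cost A x y') (limit_cost A x y) < e"
      using d(2)[of y' y x] d(2)[of y y' x] \<open>e > 0\<close>
      by (auto simp: dist_real_def dist_commute)
  qed (fact d)
qed

lemma limit_cost_triangle: "limit_cost A x y \<le> limit_cost A x z + A z y"
proof -
  obtain r where r: "strict_mono r" "(\<lambda>k. step_cost A (r k) x z) \<longlonglongrightarrow> limit_cost A x z"
    by (rule limit_cost_subsequence)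
  have lim: "filterlim r at_top sequentially" by (rule filterlim_subseq[OF r(1)])
  then have "\<forall>\<^sub>F k in sequentially. 1 \<le> r k" by (simp add: filterlim_at_top)
  moreover have "filterlim (\<lambda>k. Suc (r k)) at_top sequentially"
    using filterlim_compose[OF filterlim_Suc lim] .
  ultimately show ?thesis
    using r(2)
    by (intro limit_cost_le[where r = "\<lambda>k. Suc (r k)" and b = "\<lambda>k. step_cost A (r k) x z + A z y"])
      (auto elim!: eventually_mono intro!: tendsto_intros step_cost_Suc_le)
qed

text \<open>Along lengths realizing the liminf, the last but one points of optimal chains accumulate
  at some \<open>l\<close>, which serves as \<open>z\<close>.\<close>

lemma limit_cost_split: "\<exists>z. limit_cost A x y = limit_cost A x z + A z y"
proof -
  obtain r where r: "strict_mono r" "(\<lambda>k. step_cost A (r k) x y) \<longlonglongrightarrow> limit_cost A x y"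
    by (rule limit_cost_subsequence)
  \<comment> \<open>The shift by 2 makes \<open>r (k + 2)\<close> at least \<open>k + 2\<close>, so
    at least one link is left once the last one is split off.\<close>
  define p where "p k = r (k + 2) - 1" for k
  have p: "k + 1 \<le> p k" "r (k + 2) = Suc (p k)" for k
    using seq_suble[OF r(1), of "k + 2"] by (auto simp: p_def)
  have "\<exists>z. step_cost A (Suc (p k)) x y = step_cost A (p k) x z + A z y" for k
    using step_cost_Suc_split[of "p k" x y] p(1)[of k] by (metis add_leD2)
  then obtain z where z: "\<And>k. step_cost A (Suc (p k)) x y = step_cost A (p k) x (z k) + A (z k) y"
    by metis
  obtain s l where s: "strict_mono s" "(\<lambda>k. z (s k)) \<longlonglongrightarrow> l"
    by (rule convergent_subsequence)
  have "(\<lambda>k. step_cost A (Suc (p k)) x y) \<longlonglongrightarrow> limit_cost A x y"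
    using LIMSEQ_ignore_initial_segment[OF r(2), of 2] by (simp only: p(2))
  then have "(\<lambda>k. step_cost A (Suc (p (s k))) x y) \<longlonglongrightarrow> limit_cost A x y"
    by (rule filterlim_compose[OF _ filterlim_subseq[OF s(1)]])
  then have "(\<lambda>k. step_cost A (Suc (p (s k))) x y - A (z (s k)) y) \<longlonglongrightarrow> limit_cost A x y - A l y"
    by (intro tendsto_diff tendsto_cost s(2)) auto
  then have "(\<lambda>k. step_cost A (p (s k)) x (z (s k))) \<longlonglongrightarrow> limit_cost A x y - A l y"
    by (simp add: z)
  moreover have "filterlim (\<lambda>k. p (s k)) at_top sequentially"
  proof (rule filterlim_at_top_mono[OF filterlim_ident])
    show "\<forall>\<^sub>F k in sequentially. k \<le> p (s k)"
      using p(1) seq_suble[OF s(1)] by (intro always_eventually allI) (metis add_leE order_trans)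
  qed
  ultimately have "limit_cost A x l \<le> limit_cost A x y - A l y"
    using s(2) by (intro limit_cost_le_limit[where v = "\<lambda>_. x"]) auto
  with limit_cost_triangle[of x y l] have "limit_cost A x y = limit_cost A x l + A l y"
    by simp
  then show ?thesis ..
qed

lemma limit_cost_fixed_point: "fixed_point (T_minus A) (limit_cost A x)"
  unfolding fixed_point_T_minus_iff
  using continuous_on_limit_cost limit_cost_triangle limit_cost_split by blast

section \<open>Domination and representation of fixed points\<close>

lemma fixed_point_le_step_cost:
  assumes u: "fixed_point (T_minus A) u" and "n \<ge> 1"
  shows "u y \<le> u x + step_cost A n x y"
proof -
  obtain w where w: "w 0 = x" "w n = y" "step_cost A n x y = (\<Sum>i<n. A (w i) (w (Suc i)))"
    using step_cost_attained[OF compact continuous \<open>n \<ge> 1\<close>] by blast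
  have "u y - u x = (\<Sum>i<n. u (w (Suc i)) - u (w i))"
    using sum_lessThan_telescope[of "\<lambda>i. u (w i)" n] by (simp add: w)
  also have "\<dots> \<le> (\<Sum>i<n. A (w i) (w (Suc i)))"
    using u by (intro sum_mono) (simp add: fixed_point_T_minus_iff algebra_simps)
  finally show ?thesis using w by simp
qed

lemma fixed_point_le_limit_cost:
  assumes u: "fixed_point (T_minus A) u"
  shows "u y \<le> u x + limit_cost A x y"
proof -
  obtain r where r: "strict_mono r" "(\<lambda>k. step_cost A (r k) x y) \<longlonglongrightarrow> limit_cost A x y"
    by (rule limit_cost_subsequence)
  have "\<forall>\<^sub>F k in sequentially. 1 \<le> r k"
    using filterlim_subseq[OF r(1)] by (simp add: filterlim_at_top)
  then have "\<forall>\<^sub>F k in sequentially. u y \<le> u x + step_cost A (r k) x y"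
    by eventually_elim (rule fixed_point_le_step_cost[OF u])
  then show ?thesis
    using r(2) by (intro tendsto_lowerbound[OF tendsto_add]) auto
qed

text \<open>Take a limit point \<open>a\<close> of the backward orbit \<open>w\<close> of optimal
  predecessors. Orbit segments are optimal chains: those from near \<open>a\<close> to
  \<open>y\<close> give the formula for \<open>u y\<close>, and long ones from near \<open>a\<close>
  back to near \<open>a\<close> give \<open>limit_cost A a a \<le> 0\<close>.\<close>

lemma fixed_point_representation:
  assumes u: "fixed_point (T_minus A) u"
  obtains a where "a \<in> aubry_set A" "u y = u a + limit_cost A a y"
proof -
  from u have cont: "continuous_on UNIV u" and "\<exists>x. u y = u x + A x y" for y
    by (auto simp: fixed_point_T_minus_iff)
  then obtain g where g: "\<And>y. u y = u (g y) + A (g y) y" by metis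
  define w where "w k = (g ^^ k) y" for k
  have w: "w 0 = y" "u (w k) = u (w (Suc k)) + A (w (Suc k)) (w k)" for k
    using g[of "w k"] by (simp_all add: w_def)
  \<comment> \<open>The orbit, traversed forwards, is a chain whose cost telescopes to the lower
    bound imposed by domination.\<close>
  have cost: "step_cost A (n - m) (w n) (w m) = u (w m) - u (w n)" if "m < n" for m n
  proof (rule antisym)
    let ?z = "\<lambda>i. w (n - i)"
    have "step_cost A (n - m) (w n) (w m) \<le> (\<Sum>i<n - m. A (?z i) (?z (Suc i)))"
      using that by (intro step_cost_le) auto
    also have "\<dots> = (\<Sum>i<n - m. u (?z (Suc i)) - u (?z i))"
    proof (rule sum.cong)
      fix i
      assume "i \<in> {..<n - m}"
      then have "Suc (n - Suc i) = n - i" by auto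
      with w(2)[of "n - Suc i"] show "A (?z i) (?z (Suc i)) = u (?z (Suc i)) - u (?z i)"
        by simp
    qed simp
    also have "\<dots> = u (w m) - u (w n)"
      using that sum_lessThan_telescope[of "\<lambda>i. u (?z i)" "n - m"] by simp
    finally show "step_cost A (n - m) (w n) (w m) \<le> u (w m) - u (w n)" .
    show "u (w m) - u (w n) \<le> step_cost A (n - m) (w n) (w m)"
      using fixed_point_le_step_cost[OF u, of "n - m" "w m" "w n"] that by (simp add: Suc_le_eq)
  qed
  obtain r a where r: "strict_mono r" "(\<lambda>k. w (r k)) \<longlonglongrightarrow> a"
    by (rule convergent_subsequence)
  have lim_u: "(\<lambda>k. u (w (s k))) \<longlonglongrightarrow> u a" if "(\<lambda>k. w (s k)) \<longlonglongrightarrow> a" for s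
    using continuous_on_tendsto_compose[OF cont that] by simp
  have "(\<lambda>k. step_cost A (r k) (w (r k)) y) \<longlonglongrightarrow> u y - u a"
  proof (rule Lim_transform_eventually)
    show "(\<lambda>k. u y - u (w (r k))) \<longlonglongrightarrow> u y - u a"
      by (intro tendsto_intros lim_u r(2))
    have "step_cost A (r k) (w (r k)) y = u y - u (w (r k))" if "k > 0" for k
      using cost[of 0 "r k"] seq_suble[OF r(1), of k] that by (simp add: w(1))
    then show "\<forall>\<^sub>F k in sequentially. u y - u (w (r k)) = step_cost A (r k) (w (r k)) y"
      by (intro eventually_mono[OF eventually_gt_at_top[of 0]]) simp
  qed
  then have "limit_cost A a y \<le> u y - u a"
    using r(2) filterlim_subseq[OF r(1)] by (intro limit_cost_le_limit[where w = "\<lambda>_. y"]) auto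
  with fixed_point_le_limit_cost[OF u, of y a] have rep: "u y = u a + limit_cost A a y"
    by simp
  \<comment> \<open>The indices \<open>r k\<close> and \<open>r (2 * k)\<close> differ by at least
    \<open>k\<close>, so the orbit segments between them have lengths tending to infinity.\<close>
  have "r k + j \<le> r (k + j)" for j k
  proof (induction j)
    case (Suc j)
    with strict_monoD[OF r(1), of "k + j" "k + Suc j"] show ?case by simp
  qed simp
  then have gap: "r k + k \<le> r (2 * k)" for k
    by (metis mult_2)
  have r2: "(\<lambda>k. w (r (2 * k))) \<longlonglongrightarrow> a"
    by (rule filterlim_compose[OF r(2)], rule filterlim_subseq) (simp add: strict_mono_def)
  have "(\<lambda>k. step_cost A (r (2 * k) - r k) (w (r (2 * k))) (w (r k))) \<longlonglongrightarrow> u a - u a"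
  proof (rule Lim_transform_eventually)
    show "(\<lambda>k. u (w (r k)) - u (w (r (2 * k)))) \<longlonglongrightarrow> u a - u a"
      by (intro tendsto_intros lim_u r(2) r2)
    have "r k < r (2 * k)" if "k > 0" for k using gap[of k] that by simp
    then show "\<forall>\<^sub>F k in sequentially. u (w (r k)) - u (w (r (2 * k))) =
        step_cost A (r (2 * k) - r k) (w (r (2 * k))) (w (r k))"
      by (intro eventually_mono[OF eventually_gt_at_top[of 0]]) (simp add: cost)
  qed
  moreover have "filterlim (\<lambda>k. r (2 * k) - r k) at_top sequentially"
  proof (rule filterlim_at_top_mono[OF filterlim_ident])
    show "\<forall>\<^sub>F k in sequentially. k \<le> r (2 * k) - r k"
      proof (intro always_eventually allI)
      show "k \<le> r (2 * k) - r k" for k using gap[of k] by linarith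
    qed
  qed
  ultimately have "limit_cost A a a \<le> 0"
    using limit_cost_le_limit[OF r2 r(2)] by simp
  \<comment> \<open>Domination with both points equal to \<open>a\<close> gives the opposite
    sign.\<close>
  with fixed_point_le_limit_cost[OF u, of a a] have "a \<in> aubry_set A"
    by (simp add: aubry_set_def)
  then show thesis using rep by (rule that)
qed

section \<open>Kantorovich pairs\<close>

text \<open>\<open>\<phi>\<^sub>1\<close> is an attained minimum of the functions
  \<open>\<phi>\<^sub>0 x + limit_cost A x y\<close> of \<open>y\<close>; these are fixed points up
  to constants and share one modulus of continuity, and both properties pass to the minimum.\<close>

lemma kantorovich_pair_imp_fixed_point:
  assumes "kantorovich_pair (limit_cost A) \<phi>\<^sub>0 \<phi>\<^sub>1"
  shows "fixed_point (T_minus A) \<phi>\<^sub>1"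
proof -
  have le: "\<phi>\<^sub>1 y \<le> \<phi>\<^sub>0 x + limit_cost A x y" for x y
    using assms by (auto simp: kantorovich_pair_def is_min_def)
  have att: "\<exists>x. \<phi>\<^sub>1 y = \<phi>\<^sub>0 x + limit_cost A x y" for y
    using assms by (auto simp: kantorovich_pair_def is_min_def image_iff)
  have "continuous_on UNIV \<phi>\<^sub>1"
  proof (unfold continuous_on_iff, intro ballI allI impI)
    fix y and e :: real
    assume "e > 0"
    then obtain d where d: "d > 0"
        "\<And>x y y'. dist y y' < d \<Longrightarrow> limit_cost A x y' \<le> limit_cost A x y + e / 2"
      using limit_cost_modulus[of "e / 2"] by auto
    have *: "\<phi>\<^sub>1 y' \<le> \<phi>\<^sub>1 y + e / 2" if "dist y y' < d" for y y'
    proof -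
      obtain x where "\<phi>\<^sub>1 y = \<phi>\<^sub>0 x + limit_cost A x y" using att by blast
      with le[of y' x] d(2)[OF that, of x] show ?thesis by simp
    qed
    show "\<exists>d>0. \<forall>y'\<in>UNIV. dist y' y < d \<longrightarrow> dist (\<phi>\<^sub>1 y') (\<phi>\<^sub>1 y) < e"
    proof (intro exI conjI ballI impI)
      fix y'
      assume "dist y' y < d"
      then show "dist (\<phi>\<^sub>1 y') (\<phi>\<^sub>1 y) < e"
        using *[of y' y] *[of y y'] \<open>e > 0\<close> by (auto simp: dist_real_def dist_commute)
    qed (fact d)
  qed
  moreover have sub: "\<phi>\<^sub>1 y \<le> \<phi>\<^sub>1 z + A z y" for y z
  proof -
    obtain x where "\<phi>\<^sub>1 z = \<phi>\<^sub>0 x + limit_cost A x z" using att by blast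
    with le[of y x] limit_cost_triangle[of x y z] show ?thesis by simp
  qed
  moreover have "\<exists>z. \<phi>\<^sub>1 y = \<phi>\<^sub>1 z + A z y" for y
  proof -
    obtain x where "\<phi>\<^sub>1 y = \<phi>\<^sub>0 x + limit_cost A x y" using att by blast
    moreover obtain z where "limit_cost A x y = limit_cost A x z + A z y"
      using limit_cost_split by blast
    \<comment> \<open>Domination at \<open>z\<close> gives \<open>\<phi>\<^sub>1 z + A z y \<le>
      \<phi>\<^sub>0 x + limit_cost A x y\<close>, whose right side is
      \<open>\<phi>\<^sub>1 y\<close>; \<open>sub\<close> is the converse.\<close>
    ultimately have "\<phi>\<^sub>1 y = \<phi>\<^sub>1 z + A z y"
      using le[of z x] sub[of y z] by simp
    then show ?thesis ..
  qed
  ultimately show ?thesis by (simp add: fixed_point_T_minus_iff)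
qed

text \<open>Domination of \<open>\<phi>\<^sub>1\<close> gives
  \<open>\<phi>\<^sub>0 \<le> \<phi>\<^sub>1\<close> at every point; the reverse inequality costs
  \<open>limit_cost A x x\<close>, which vanishes on the Aubry set.\<close>

lemma kantorovich_pair_eq_on_aubry_set:
  assumes pair: "kantorovich_pair (limit_cost A) \<phi>\<^sub>0 \<phi>\<^sub>1" and "x \<in> aubry_set A"
  shows "\<phi>\<^sub>0 x = \<phi>\<^sub>1 x"
proof -
  obtain y where "\<phi>\<^sub>0 x = \<phi>\<^sub>1 y - limit_cost A x y"
    using pair unfolding kantorovich_pair_def is_max_def image_iff by blast
  with fixed_point_le_limit_cost[OF kantorovich_pair_imp_fixed_point[OF pair], of y x]
  have "\<phi>\<^sub>0 x \<le> \<phi>\<^sub>1 x" by simp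
  moreover have "\<phi>\<^sub>1 x \<le> \<phi>\<^sub>0 x + limit_cost A x x"
    using pair by (auto simp: kantorovich_pair_def is_min_def)
  ultimately show ?thesis
    using assms(2) by (simp add: aubry_set_def)
qed

text \<open>The representation of \<open>\<phi>\<^sub>1\<close> supplies a minimizer in the Aubry
  set. For the lower bound, the cost from \<open>x\<close> to \<open>y\<close> is routed through an
  Aubry point \<open>a\<close>, where \<open>\<phi>\<^sub>0\<close> and
  \<open>\<phi>\<^sub>1\<close> can be exchanged.\<close>

lemma is_min_of_fixed_points:
  assumes plus: "\<And>x y. \<phi>\<^sub>0 y \<le> \<phi>\<^sub>0 x + limit_cost A x y"
    and minus: "fixed_point (T_minus A) \<phi>\<^sub>1"
    and eq: "\<And>x. x \<in> aubry_set A \<Longrightarrow> \<phi>\<^sub>0 x = \<phi>\<^sub>1 x"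
  shows "is_min (\<lambda>x. \<phi>\<^sub>0 x + limit_cost A x y) (\<phi>\<^sub>1 y)"
  unfolding is_min_def
proof (intro conjI allI)
  obtain a where "a \<in> aubry_set A" "\<phi>\<^sub>1 y = \<phi>\<^sub>1 a + limit_cost A a y"
    by (rule fixed_point_representation[OF minus])
  then show "\<phi>\<^sub>1 y \<in> range (\<lambda>x. \<phi>\<^sub>0 x + limit_cost A x y)"
    using eq by (intro image_eqI[of _ _ a]) auto
next
  fix x
  \<comment> \<open>The representation is applied to the fixed point \<open>limit_cost A x\<close>
    itself.\<close>
  obtain a where a: "a \<in> aubry_set A" "limit_cost A x y = limit_cost A x a + limit_cost A a y"
    by (rule fixed_point_representation[OF limit_cost_fixed_point])
  have "\<phi>\<^sub>1 y \<le> \<phi>\<^sub>1 a + limit_cost A a y"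
    by (rule fixed_point_le_limit_cost[OF minus])
  with plus[of a x] a eq[of a] show "\<phi>\<^sub>1 y \<le> \<phi>\<^sub>0 x + limit_cost A x y" by simp
qed

text \<open>Negating \<open>u\<close> and transposing the cost each reverse the inequality, so it is
  the same as for \<open>T_minus\<close>.\<close>

lemma fixed_point_T_plus_le_limit_cost:
  assumes "fixed_point (T_plus A) u"
  shows "u y \<le> u x + limit_cost A x y"
proof -
  interpret T: zero_growth_cost "\<lambda>x y. A y x" by (rule transpose)
  show ?thesis
    using T.fixed_point_le_limit_cost[of "\<lambda>x. - u x" x y] assms
    by (simp add: fixed_point_T_plus_iff limit_cost_transpose[of A])
qed

lemma kantorovich_pair_iff:
  "kantorovich_pair (limit_cost A) \<phi>\<^sub>0 \<phi>\<^sub>1 \<longleftrightarrow>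
     fixed_point (T_plus A) \<phi>\<^sub>0 \<and> fixed_point (T_minus A) \<phi>\<^sub>1 \<and> (\<forall>x\<in>aubry_set A. \<phi>\<^sub>0 x = \<phi>\<^sub>1 x)"
proof (intro iffI conjI ballI; (elim conjE)?)
  interpret T: zero_growth_cost "\<lambda>x y. A y x" by (rule transpose)
  have c: "limit_cost (\<lambda>x y. A y x) = (\<lambda>x y. limit_cost A y x)"
    by (simp add: fun_eq_iff limit_cost_transpose[of A])
  {
    assume pair: "kantorovich_pair (limit_cost A) \<phi>\<^sub>0 \<phi>\<^sub>1"
    then show "fixed_point (T_plus A) \<phi>\<^sub>0"
      unfolding fixed_point_T_plus_iff
      by (intro T.kantorovich_pair_imp_fixed_point[of "\<lambda>x. - \<phi>\<^sub>1 x"])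
        (simp add: c kantorovich_pair_transpose[of "limit_cost A"])
    show "fixed_point (T_minus A) \<phi>\<^sub>1"
      by (rule kantorovich_pair_imp_fixed_point[OF pair])
    show "\<phi>\<^sub>0 x = \<phi>\<^sub>1 x" if "x \<in> aubry_set A" for x
      by (rule kantorovich_pair_eq_on_aubry_set[OF pair that])
  next
    assume plus: "fixed_point (T_plus A) \<phi>\<^sub>0" and minus: "fixed_point (T_minus A) \<phi>\<^sub>1"
      and eq: "\<forall>x\<in>aubry_set A. \<phi>\<^sub>0 x = \<phi>\<^sub>1 x"
    have "is_min (\<lambda>x. \<phi>\<^sub>0 x + limit_cost A x y) (\<phi>\<^sub>1 y)" for y
      using fixed_point_T_plus_le_limit_cost[OF plus] minus eq
      by (intro is_min_of_fixed_points) auto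
    \<comment> \<open>The maximum is the minimum just obtained, for the transposed cost and the pair
      \<open>- \<phi>\<^sub>1\<close>, \<open>- \<phi>\<^sub>0\<close>.\<close>
    moreover have "is_max (\<lambda>y. \<phi>\<^sub>1 y - limit_cost A x y) (\<phi>\<^sub>0 x)" for x
    proof -
      have "- \<phi>\<^sub>1 y \<le> - \<phi>\<^sub>1 x + limit_cost (\<lambda>x y. A y x) x y" for x y
        using fixed_point_le_limit_cost[OF minus, of x y] by (simp add: c)
      then have "is_min (\<lambda>y. - \<phi>\<^sub>1 y + limit_cost (\<lambda>x y. A y x) y x) (- \<phi>\<^sub>0 x)"
        using plus eq
        by (intro T.is_min_of_fixed_points) (auto simp: aubry_set_transpose[of A] fixed_point_T_plus_iff)
      then show ?thesis
        using is_min_uminus[of "\<lambda>y. \<phi>\<^sub>1 y - limit_cost A x y" "\<phi>\<^sub>0 x"] by (simp add: c)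
    qed
    ultimately show "kantorovich_pair (limit_cost A) \<phi>\<^sub>0 \<phi>\<^sub>1"
      by (simp add: kantorovich_pair_def)
  }
qed

lemma ex1_kantorovich_pair:
  assumes u: "fixed_point (T_minus A) \<phi>\<^sub>1"
  shows "\<exists>!\<phi>\<^sub>0. kantorovich_pair (limit_cost A) \<phi>\<^sub>0 \<phi>\<^sub>1"
proof (rule ex_ex1I)
  \<comment> \<open>The second half of admissibility forces this choice; what has to be checked is
    that minimizing gives back \<open>\<phi>\<^sub>1\<close>.\<close>
  define \<phi>\<^sub>0 where "\<phi>\<^sub>0 x = (SUP y. \<phi>\<^sub>1 y - limit_cost A x y)" for x
  have max: "is_max (\<lambda>y. \<phi>\<^sub>1 y - limit_cost A x y) (\<phi>\<^sub>0 x)" for x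
    unfolding \<phi>\<^sub>0_def using u
    by (intro is_max_SUP compact continuous_on_diff continuous_on_limit_cost)
      (simp add: fixed_point_def)
  have le: "\<phi>\<^sub>1 y \<le> \<phi>\<^sub>0 x + limit_cost A x y" for x y
    using max[of x] by (auto simp: is_max_def algebra_simps)
  have "is_min (\<lambda>x. \<phi>\<^sub>0 x + limit_cost A x y) (\<phi>\<^sub>1 y)" for y
  proof -
    obtain a where a: "\<phi>\<^sub>1 y = \<phi>\<^sub>1 a + limit_cost A a y"
      by (rule fixed_point_representation[OF u])
    obtain z where "\<phi>\<^sub>0 a = \<phi>\<^sub>1 z - limit_cost A a z"
      using max[of a] by (auto simp: is_max_def)
    with fixed_point_le_limit_cost[OF u, of z a] have "\<phi>\<^sub>0 a \<le> \<phi>\<^sub>1 a" by simp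
    \<comment> \<open>The point \<open>a\<close> representing \<open>\<phi>\<^sub>1 y\<close> is a
      minimizer, since \<open>\<phi>\<^sub>0 a \<le> \<phi>\<^sub>1 a\<close>.\<close>
    with a le[of y a] have "\<phi>\<^sub>1 y = \<phi>\<^sub>0 a + limit_cost A a y" by simp
    with le show ?thesis unfolding is_min_def by blast
  qed
  with max show "\<exists>\<phi>\<^sub>0. kantorovich_pair (limit_cost A) \<phi>\<^sub>0 \<phi>\<^sub>1"
    unfolding kantorovich_pair_def by blast
next
  fix f g
  assume "kantorovich_pair (limit_cost A) f \<phi>\<^sub>1" "kantorovich_pair (limit_cost A) g \<phi>\<^sub>1"
  then show "f = g"
    by (auto simp: kantorovich_pair_def fun_eq_iff intro: is_max_unique)
qed

end

theorem theorem12: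
  fixes A :: "'a::metric_space \<Rightarrow> 'a \<Rightarrow> real"
  assumes "compact (UNIV :: 'a set)"
    and "connected (UNIV :: 'a set)"
    and "continuous_on UNIV (\<lambda>(x, y). A x y)"
    and "has_growth_rate A 0"
  shows "(\<forall>\<phi>\<^sub>0 \<phi>\<^sub>1. kantorovich_pair (limit_cost A) \<phi>\<^sub>0 \<phi>\<^sub>1 \<longleftrightarrow>
            fixed_point (T_plus A) \<phi>\<^sub>0 \<and>
            fixed_point (T_minus A) \<phi>\<^sub>1 \<and>
            (\<forall>x\<in>aubry_set A. \<phi>\<^sub>0 x = \<phi>\<^sub>1 x)) \<and>
         (\<forall>\<phi>\<^sub>1. fixed_point (T_minus A) \<phi>\<^sub>1 \<longrightarrow>
            (\<exists>!\<phi>\<^sub>0. kantorovich_pair (limit_cost A) \<phi>\<^sub>0 \<phi>\<^sub>1))"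
proof -
  interpret zero_growth_cost A by unfold_locales (use assms in auto)
  show ?thesis
    using kantorovich_pair_iff ex1_kantorovich_pair by blast
qed

end
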